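(* Let $A=[a_{ij}]\in\mathbb{R}^{n\times n}$, $n\ge 2$, be a bdsw matrix with $a_{n1}>0$ and $a_{nn}=0$. Then the following are equivalent: (i) $A\in\mathbf{Q}$. (ii) $a_{ii}>0$ for $i=1,2,\dots,n-1$, and $A$ has negative superdiagonal (i.e., $a_{i(i+1)}<0$ for $i=1,\dots,n-1$). (iii) $A\in\mathbf{R}^*$. Furthermore, in each case (i.e., whenever one of these equivalent conditions holds), $\det A>0$.
   Context: A matrix $A=[a_{ij}]\in\mathbb{R}^{n\times n}$, $n\ge 2$, is a bidiagonal southwest (bdsw) matrix if $a_{ij}=0$ unless $j=i$, or $j=i+1$, or $(i,j)=(n,1)$; the entries in these positions are arbitrary real numbers (possibly zero). For $A\in\mathbb{R}^{n\times n}$ and $q\in\mathbb{R}^n$, $\mathrm{LCP}(A,q)$ is the problem of finding $x\in\mathbb{R}^n$ with $x\ge 0$, $Ax+q\ge 0$ and $x^\top(Ax+q)=0$ (inequalities between vectors are componentwise; $d>0$ means all components of $d$ are positive). - $A\in\mathbf{Q}$ if $\mathrm{LCP}(A,q)$ has a solution for every $q\in\mathbb{R}^n$. - $A\in\mathbf{R}_0$ if $x=0$ is the only solution of $\mathrm{LCP}(A,0)$. - $A\in\mathbf{E}_0$ if for every $d>0$ in $\mathbb{R}^n$, $x=0$ is the only solution of $\mathrm{LCP}(A,d)$. - $A\in\mathbf{R}^*$ if $A\in\mathbf{R}_0$ and $A\in\mathbf{E}_0$. *)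

theory Defs
  imports "Jordan_Normal_Form.Determinant"
begin

text \<open>Row and column indices of \<open>real mat\<close> start at 0: the entry \<open>a\<^sub>i\<^sub>j\<close> is \<open>A $$ (i - 1, j - 1)\<close>.\<close>

definition bdsw :: "nat \<Rightarrow> real mat \<Rightarrow> bool" where
  "bdsw n A \<longleftrightarrow> A \<in> carrier_mat n n \<and>
     (\<forall>i<n. \<forall>j<n. \<not> (j = i \<or> j = i + 1 \<or> (i = n - 1 \<and> j = 0)) \<longrightarrow> A $$ (i, j) = 0)"

text \<open>On vectors of equal dimension, the library's \<open>\<le>\<close> is componentwise.\<close>

definition LCP :: "nat \<Rightarrow> real mat \<Rightarrow> real vec \<Rightarrow> real vec set" where
  "LCP n A q = {x \<in> carrier_vec n.
     0\<^sub>v n \<le> x \<and> 0\<^sub>v n \<le> A *\<^sub>v x + q \<and> x \<bullet> (A *\<^sub>v x + q) = 0}"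

text \<open>The library's \<open><\<close> on vectors is the strict part of \<open>\<le>\<close>, which only requires some
  component to be strictly larger.\<close>

definition pos_vec :: "nat \<Rightarrow> real vec \<Rightarrow> bool" where
  "pos_vec n d \<longleftrightarrow> d \<in> carrier_vec n \<and> (\<forall>i<n. d $ i > 0)"

definition Q_mats :: "nat \<Rightarrow> real mat set" where
  "Q_mats n = {A \<in> carrier_mat n n. \<forall>q \<in> carrier_vec n. LCP n A q \<noteq> {}}"

definition R0_mats :: "nat \<Rightarrow> real mat set" where
  "R0_mats n = {A \<in> carrier_mat n n. LCP n A (0\<^sub>v n) = {0\<^sub>v n}}"

definition E0_mats :: "nat \<Rightarrow> real mat set" where
  "E0_mats n = {A \<in> carrier_mat n n. \<forall>d. pos_vec n d \<longrightarrow> LCP n A d = {0\<^sub>v n}}"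

definition Rstar_mats :: "nat \<Rightarrow> real mat set" where
  "Rstar_mats n = R0_mats n \<inter> E0_mats n"

end

theory Submission
  imports Defs
begin

text \<open>The first \<open>n - 1\<close> rows of the complementarity problem are solved by back substitution,
  \<open>x\<^sub>i = max 0 ((- q\<^sub>i - a\<^bsub>i,i+1\<^esub> x\<^bsub>i+1\<^esub>) / a\<^bsub>i,i\<^esub>)\<close>, from a prescribed last component \<open>t\<close>. With negative
  superdiagonal, \<open>x\<^sub>1\<close> is a continuous function of \<open>t\<close> that grows at least linearly, so by the
  intermediate value theorem some \<open>t\<close> satisfies the last row as well. Conversely, if (ii) fails, then
  either some \<open>a\<^bsub>i,i\<^esub> < 0\<close> and a unit vector refutes E0, or back substitution for \<open>q = 0\<close> yields a
  nonzero solution against R0; and solutions for \<open>q = (1, \<dots>, 1, -1, 1, \<dots>, 1)\<close> show that Q implies (ii).\<close>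

text \<open>For a feasible \<open>x\<close> the inner product is a sum of nonnegative terms, so it
  vanishes exactly when every term does.\<close>

lemma mem_LCP_iff:
  assumes "A \<in> carrier_mat n n" "x \<in> carrier_vec n" "q \<in> carrier_vec n"
  shows "x \<in> LCP n A q \<longleftrightarrow>
    (\<forall>i<n. 0 \<le> x $ i \<and> 0 \<le> (A *\<^sub>v x) $ i + q $ i \<and> x $ i * ((A *\<^sub>v x) $ i + q $ i) = 0)"
proof -
  have sp: "x \<bullet> (A *\<^sub>v x + q) = (\<Sum>i<n. x $ i * ((A *\<^sub>v x) $ i + q $ i))"
    using assms by (auto simp: scalar_prod_def lessThan_atLeast0 intro!: sum.cong)
  have "x \<bullet> (A *\<^sub>v x + q) = 0 \<longleftrightarrow> (\<forall>i<n. x $ i * ((A *\<^sub>v x) $ i + q $ i) = 0)"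
    if "\<forall>i<n. 0 \<le> x $ i \<and> 0 \<le> (A *\<^sub>v x) $ i + q $ i"
    unfolding sp using that by (subst sum_nonneg_eq_0_iff) auto
  then show ?thesis
    using assms by (auto simp: LCP_def less_eq_vec_def)
qed

lemma zero_mem_LCP:
  assumes "A \<in> carrier_mat n n" "d \<in> carrier_vec n" "\<And>i. i < n \<Longrightarrow> 0 \<le> d $ i"
  shows "0\<^sub>v n \<in> LCP n A d"
  using assms by (subst mem_LCP_iff) auto

section \<open>Back substitution along the superdiagonal\<close>

primrec back_subst ::
  "(nat \<Rightarrow> real) \<Rightarrow> (nat \<Rightarrow> real) \<Rightarrow> (nat \<Rightarrow> real) \<Rightarrow> nat \<Rightarrow> real \<Rightarrow> nat \<Rightarrow> real" where
  "back_subst a b q k t 0 = t"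
| "back_subst a b q k t (Suc m) =
     max 0 ((- q (k - Suc m) - b (k - Suc m) * back_subst a b q k t m) / a (k - Suc m))"

text \<open>\<open>back_subst\<close> counts steps down from the last index; this reindexes it by
  position. The value 0 beyond \<open>k\<close> lets a chain that stops at an earlier index serve as
  a full candidate vector, as in \<open>Rstar_imp_sign_cond\<close>.\<close>

definition chain ::
  "(nat \<Rightarrow> real) \<Rightarrow> (nat \<Rightarrow> real) \<Rightarrow> (nat \<Rightarrow> real) \<Rightarrow> nat \<Rightarrow> real \<Rightarrow> nat \<Rightarrow> real" where
  "chain a b q k t i = (if i \<le> k then back_subst a b q k t (k - i) else 0)"

lemma chain_last [simp]: "chain a b q k t k = t"
  by (simp add: chain_def)

lemma chain_above: "k < i \<Longrightarrow> chain a b q k t i = 0"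
  by (simp add: chain_def)

lemma chain_step:
  assumes "i < k"
  shows "chain a b q k t i = max 0 ((- q i - b i * chain a b q k t (Suc i)) / a i)"
proof -
  have "k - i = Suc (k - Suc i)" "k - Suc (k - Suc i) = i" using assms by auto
  then show ?thesis using assms by (simp add: chain_def)
qed

lemma chain_nonneg: "0 \<le> t \<Longrightarrow> 0 \<le> chain a b q k t i"
  by (cases i k rule: linorder_cases) (auto simp: chain_step chain_above)

text \<open>Either the root of the affine equation of row \<open>i\<close> is nonnegative and is
  taken, so the slack is zero, or it is negative and the value 0 leaves a positive slack. No sign of
  \<open>b i\<close> is involved.\<close>

lemma chain_complementary:
  fixes a b q k t
  defines "x \<equiv> chain a b q k t"
  assumes "i < k" "0 < a i"
  shows "0 \<le> a i * x i + b i * x (Suc i) + q i"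
    and "x i * (a i * x i + b i * x (Suc i) + q i) = 0"
proof -
  have x: "x i = max 0 ((- q i - b i * x (Suc i)) / a i)"
    using assms chain_step by simp
  have "0 \<le> a i * x i + b i * x (Suc i) + q i \<and> x i * (a i * x i + b i * x (Suc i) + q i) = 0"
  proof (cases "0 \<le> (- q i - b i * x (Suc i)) / a i")
    case True
    then have "a i * x i = - q i - b i * x (Suc i)" using x \<open>0 < a i\<close> by simp
    then show ?thesis by simp
  next
    case False
    then have "x i = 0" using x by simp
    moreover have "- q i - b i * x (Suc i) < 0" using False \<open>0 < a i\<close> by (simp add: field_simps)
    ultimately show ?thesis by simp
  qed
  then show "0 \<le> a i * x i + b i * x (Suc i) + q i"
    and "x i * (a i * x i + b i * x (Suc i) + q i) = 0" by auto
qed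

lemma back_subst_continuous: "continuous_on S (\<lambda>t. back_subst a b q k t m)"
  by (induction m) (auto intro!: continuous_intros simp: divide_inverse)

lemma chain_continuous: "continuous_on S (\<lambda>t. chain a b q k t i)"
  unfolding chain_def using back_subst_continuous by (cases "i \<le> k") auto

text \<open>Going down one index multiplies the slope by \<open>- b i / a i > 0\<close> and shifts
  the constant; truncation at 0 can only raise the value.\<close>

lemma chain_linear_growth:
  assumes "\<And>i. i < k \<Longrightarrow> 0 < a i" "\<And>i. i < k \<Longrightarrow> b i < 0" "j \<le> k"
  shows "\<exists>\<alpha>>0. \<exists>\<beta>. \<forall>t. \<alpha> * t + \<beta> \<le> chain a b q k t j"
  using \<open>j \<le> k\<close>
proof (induction j rule: inc_induct)
  case base
  show ?case by (intro exI[of _ 1] conjI exI[of _ 0]) auto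
next
  case (step i)
  obtain \<alpha> \<beta> where "\<alpha> > 0" and IH: "\<And>t. \<alpha> * t + \<beta> \<le> chain a b q k t (Suc i)"
    using step.IH by blast
  define r where "r = - b i / a i"
  have "r > 0" using assms step.hyps by (simp add: r_def divide_neg_pos)
  have "(r * \<alpha>) * t + (r * \<beta> - q i / a i) \<le> chain a b q k t i" for t
  proof -
    have "(r * \<alpha>) * t + (r * \<beta> - q i / a i) = r * (\<alpha> * t + \<beta>) - q i / a i"
      by (simp add: algebra_simps)
    also have "\<dots> \<le> r * chain a b q k t (Suc i) - q i / a i"
      using IH[of t] \<open>r > 0\<close> by simp
    also have "\<dots> = (- q i - b i * chain a b q k t (Suc i)) / a i"
      by (simp add: r_def diff_divide_distrib)
    also have "\<dots> \<le> chain a b q k t i"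
      using step.hyps by (simp add: chain_step)
    finally show ?thesis .
  qed
  moreover have "r * \<alpha> > 0" using \<open>r > 0\<close> \<open>\<alpha> > 0\<close> by simp
  ultimately show ?case by blast
qed

text \<open>For \<open>q = 0\<close> each component is the truncation of a multiple of the next one,
  so a zero propagates downwards.\<close>

lemma chain_zero_below:
  assumes "chain a b (\<lambda>_. 0) k t j = 0" "i \<le> j" "j \<le> k"
  shows "chain a b (\<lambda>_. 0) k t i = 0"
  using \<open>i \<le> j\<close>
proof (induction i rule: inc_induct)
  case base
  show ?case using assms by simp
next
  case (step i)
  then show ?case using \<open>j \<le> k\<close> by (simp add: chain_step)
qed

section \<open>Row-wise form of the problem for a bdsw matrix\<close>

locale bdsw_lcp =
  fixes A :: "real mat" and n k :: nat
  assumes n_eq: "n = Suc k"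
    and k_pos: "0 < k"
    and bdsw: "bdsw n A"
    and corner_pos: "A $$ (k, 0) > 0"
    and last_diag: "A $$ (k, k) = 0"
begin

definition a :: "nat \<Rightarrow> real" where "a i = A $$ (i, i)"
definition b :: "nat \<Rightarrow> real" where "b i = A $$ (i, i + 1)"
definition c :: real where "c = A $$ (k, 0)"

lemma c_pos: "c > 0"
  using corner_pos by (simp add: c_def)

lemma carrier: "A \<in> carrier_mat n n"
  using bdsw by (simp add: bdsw_def)

lemma entry_zero:
  "i < n \<Longrightarrow> j < n \<Longrightarrow> j \<noteq> i \<Longrightarrow> j \<noteq> Suc i \<Longrightarrow> \<not> (i = k \<and> j = 0) \<Longrightarrow> A $$ (i, j) = 0"
  using bdsw unfolding bdsw_def by (simp add: n_eq)

lemma mult_vec: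
  assumes "x \<in> carrier_vec n" "i < n"
  shows "(A *\<^sub>v x) $ i = (\<Sum>j<n. A $$ (i, j) * x $ j)"
  using assms carrier by (auto simp: scalar_prod_def lessThan_atLeast0 intro!: sum.cong)

lemma mult_vec_row:
  assumes "x \<in> carrier_vec n" "i < k"
  shows "(A *\<^sub>v x) $ i = a i * x $ i + b i * x $ Suc i"
proof -
  have "(\<Sum>j<n. A $$ (i, j) * x $ j) = (\<Sum>j\<in>{i, Suc i}. A $$ (i, j) * x $ j)"
    using assms n_eq entry_zero[of i] by (intro sum.mono_neutral_right) auto
  then show ?thesis using assms n_eq by (simp add: mult_vec a_def b_def)
qed

lemma mult_vec_last:
  assumes "x \<in> carrier_vec n"
  shows "(A *\<^sub>v x) $ k = c * x $ 0"
proof -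
  have "A $$ (k, j) = 0" if "j < n" "j \<noteq> 0" for j
    using that last_diag entry_zero[of k j] n_eq by (cases "j = k") auto
  then have "(\<Sum>j<n. A $$ (k, j) * x $ j) = (\<Sum>j\<in>{0}. A $$ (k, j) * x $ j)"
    using n_eq by (intro sum.mono_neutral_right) auto
  then show ?thesis using assms n_eq by (simp add: mult_vec c_def)
qed

lemma mem_LCP:
  assumes "x \<in> carrier_vec n" "q \<in> carrier_vec n"
  shows "x \<in> LCP n A q \<longleftrightarrow>
    (\<forall>i<k. 0 \<le> x $ i \<and> 0 \<le> a i * x $ i + b i * x $ Suc i + q $ i \<and>
       x $ i * (a i * x $ i + b i * x $ Suc i + q $ i) = 0) \<and>
    0 \<le> x $ k \<and> 0 \<le> c * x $ 0 + q $ k \<and> x $ k * (c * x $ 0 + q $ k) = 0"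
  unfolding mem_LCP_iff[OF carrier assms]
  using mult_vec_row[OF assms(1)] mult_vec_last[OF assms(1)]
  by (auto simp: n_eq less_Suc_eq)

section \<open>The sign conditions of (ii): sufficiency, necessity, determinant\<close>

definition sign_cond :: bool where
  "sign_cond \<longleftrightarrow> (\<forall>i<k. 0 < a i) \<and> (\<forall>i<k. b i < 0)"

text \<open>The two alternatives for \<open>d\<close> cover E0 and R0 at once. Complementarity in
  the last row gives a zero at one end of \<open>x\<close>: from \<open>x $ k = 0\<close>
  complementarity carries it down, and from \<open>x $ 0 = 0\<close> with \<open>d\<close> zero
  feasibility carries it up.\<close>

lemma sign_cond_imp_trivial_LCP:
  assumes "sign_cond" and d: "d \<in> carrier_vec n"
    and d_cases: "(\<forall>i<n. 0 < d $ i) \<or> (\<forall>i<n. d $ i = 0)"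
    and x: "x \<in> LCP n A d"
  shows "x = 0\<^sub>v n"
proof -
  have xc: "x \<in> carrier_vec n" using x by (simp add: LCP_def)
  note s = x[unfolded mem_LCP[OF xc d]]
  have d0: "0 \<le> d $ i" if "i \<le> k" for i using d_cases that n_eq by (auto simp: less_imp_le)
  have nonneg: "0 \<le> x $ i" if "i \<le> k" for i using s that by (cases "i = k") auto
  have "x $ k = 0 \<or> (x $ 0 = 0 \<and> (\<forall>i<n. d $ i = 0))"
  proof (rule ccontr)
    assume *: "\<not> ?thesis"
    \<comment> \<open>Both summands are nonnegative, so each vanishes; \<open>d $ k = 0\<close>
      excludes a strictly positive \<open>d\<close>.\<close>
    then have "c * x $ 0 + d $ k = 0" using s by simp
    moreover have "0 \<le> c * x $ 0" using c_pos nonneg[of 0] by simp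
    ultimately have "d $ k = 0" "c * x $ 0 = 0" using d0[of k] by linarith+
    then show False using * d_cases c_pos n_eq by auto
  qed
  then have "\<forall>i\<le>k. x $ i = 0"
  proof
    assume xk: "x $ k = 0"
    have "x $ i = 0" if "i \<le> k" for i
      using that
    proof (induction i rule: inc_induct)
      case base
      show ?case by (rule xk)
    next
      case (step i)
      have "x $ i * (a i * x $ i + d $ i) = 0" using s step by auto
      then have "x $ i = 0 \<or> a i * x $ i + d $ i = 0" by simp
      moreover have "0 < a i" using \<open>sign_cond\<close> step by (simp add: sign_cond_def)
      moreover have "0 < a i * x $ i" if "0 < x $ i" using that \<open>0 < a i\<close> by simp
      ultimately show ?case using nonneg[of i] d0[of i] step.hyps by fastforce
    qed
    then show ?thesis by simp
  next
    assume x0: "x $ 0 = 0 \<and> (\<forall>i<n. d $ i = 0)"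
    have "x $ i = 0" if "i \<le> k" for i
      using that
    proof (induction i)
      case 0
      show ?case using x0 by simp
    next
      case (Suc i)
      have "0 \<le> a i * x $ i + b i * x $ Suc i + d $ i" using s Suc.prems by simp
      moreover have "x $ i = 0" "d $ i = 0" using Suc x0 n_eq by auto
      ultimately have "0 \<le> b i * x $ Suc i" by simp
      moreover have "b i < 0" using \<open>sign_cond\<close> Suc by (simp add: sign_cond_def)
      ultimately show ?case using nonneg[OF Suc.prems] by (simp add: zero_le_mult_iff)
    qed
    then show ?thesis by simp
  qed
  then show ?thesis using xc n_eq by (intro eq_vecI) auto
qed

lemma sign_cond_imp_Rstar:
  assumes "sign_cond"
  shows "A \<in> Rstar_mats n"
proof -
  have "LCP n A d = {0\<^sub>v n}"
    if "d \<in> carrier_vec n" "(\<forall>i<n. 0 < d $ i) \<or> (\<forall>i<n. d $ i = 0)" for d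
  proof -
    have "0 \<le> d $ i" if "i < n" for i
      using that \<open>(\<forall>i<n. 0 < d $ i) \<or> (\<forall>i<n. d $ i = 0)\<close> by force
    then show ?thesis
      using sign_cond_imp_trivial_LCP[OF assms that] zero_mem_LCP[OF carrier that(1)] by blast
  qed
  then show ?thesis
    using carrier by (auto simp: Rstar_mats_def R0_mats_def E0_mats_def pos_vec_def)
qed

lemma sign_cond_imp_Q:
  assumes "sign_cond"
  shows "A \<in> Q_mats n"
proof -
  have "LCP n A q \<noteq> {}" if q: "q \<in> carrier_vec n" for q
  proof -
    define f where "f = (\<lambda>t. chain a b (($) q) k t)"
    have sc: "\<And>i. i < k \<Longrightarrow> 0 < a i" "\<And>i. i < k \<Longrightarrow> b i < 0"
      using assms by (auto simp: sign_cond_def)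
    obtain t where t: "0 \<le> t" "0 \<le> c * f t 0 + q $ k" "t * (c * f t 0 + q $ k) = 0"
    proof (cases "0 \<le> c * f 0 0 + q $ k")
      case True
      then show ?thesis by (intro that[of 0]) auto
    next
      case False
      obtain \<alpha> \<beta> where "\<alpha> > 0" and growth: "\<And>t. \<alpha> * t + \<beta> \<le> f t 0"
        using chain_linear_growth[of k a b 0 "($) q"] sc unfolding f_def by blast
      \<comment> \<open>At the untruncated value the linear lower bound equals
        \<open>- q $ k / c\<close>, so the last row is feasible at \<open>T\<close>; truncation
        ensures \<open>0 \<le> T\<close>.\<close>
      define T where "T = max 0 ((- q $ k / c - \<beta>) / \<alpha>)"
      have "(- q $ k / c - \<beta>) / \<alpha> \<le> T" by (simp add: T_def)
      then have "- q $ k / c \<le> \<alpha> * T + \<beta>" using \<open>\<alpha> > 0\<close> by (simp add: field_simps)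
      then have "- q $ k / c \<le> f T 0" using growth[of T] by linarith
      then have "0 \<le> c * f T 0 + q $ k" using c_pos by (simp add: field_simps)
      moreover have "0 \<le> T" by (simp add: T_def)
      moreover have "continuous_on {0..T} (\<lambda>t. c * f t 0 + q $ k)"
        unfolding f_def by (intro continuous_intros chain_continuous)
      ultimately obtain t where "0 \<le> t" "c * f t 0 + q $ k = 0"
        using IVT'[of "\<lambda>t. c * f t 0 + q $ k" 0 0 T] False by auto
      then show ?thesis by (intro that[of t]) auto
    qed
    have "vec n (f t) \<in> LCP n A q"
      using t q sc chain_complementary[where a=a and b=b and q="($) q" and k=k and t=t]
        chain_nonneg[OF t(1)] n_eq
      by (subst mem_LCP) (auto simp: f_def)
    then show ?thesis by blast
  qed
  then show ?thesis using carrier by (simp add: Q_mats_def)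
qed

text \<open>An entry -1 of \<open>q\<close> at \<open>i < k\<close> isolates \<open>a i\<close>,
  since the components of \<open>x\<close> above \<open>i\<close> vanish. An entry -1 at
  \<open>k\<close> forces \<open>x $ 0 > 0\<close>, and complementarity against the entries 1 then
  passes positivity up the chain, which is possible only if every \<open>b i\<close> is
  negative.\<close>

lemma Q_imp_sign_cond:
  assumes "A \<in> Q_mats n"
  shows "sign_cond"
proof -
  have a_pos: "0 < a i" if "i < k" for i
    using that
  \<comment> \<open>The measure makes the diagonal entries at larger indices available as
    positive.\<close>
  proof (induction "k - i" arbitrary: i rule: less_induct)
    case less
    define q :: "real vec" where "q = vec n (\<lambda>j. if j = i then -1 else 1)"
    have q: "q \<in> carrier_vec n" by (simp add: q_def)
    obtain x where x: "x \<in> LCP n A q" using assms q by (auto simp: Q_mats_def)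
    have xc: "x \<in> carrier_vec n" using x by (simp add: LCP_def)
    note s = x[unfolded mem_LCP[OF xc q]]
    have "x $ j = 0" if "Suc i \<le> j" "j \<le> k" for j
      using \<open>j \<le> k\<close> \<open>Suc i \<le> j\<close>
    proof (induction j rule: inc_induct)
      case base
      \<comment> \<open>Since \<open>i < k\<close>, the entry \<open>q $ k\<close> is 1; the
        positive slack forces \<open>x $ k = 0\<close>.\<close>
      have "0 < c * x $ 0 + q $ k"
        using s k_pos c_pos base n_eq less.prems by (auto simp: q_def intro!: add_nonneg_pos)
      then show ?case using s by simp
    next
      case (step j)
      have "0 < a j" using step less by simp
      moreover have "x $ Suc j = 0" "0 \<le> x $ j" using step s by auto
      ultimately have "0 < a j * x $ j + b j * x $ Suc j + q $ j"
        using step n_eq by (auto simp: q_def intro!: add_nonneg_pos)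
      moreover have "x $ j * (a j * x $ j + b j * x $ Suc j + q $ j) = 0" using s step by blast
      ultimately show ?case by simp
    qed
    then have "0 \<le> a i * x $ i - 1"
      using s less.prems n_eq by (auto simp: q_def)
    moreover have "0 \<le> x $ i" using s less.prems by blast
    ultimately show ?case by (smt (verit) mult_nonpos_nonneg)
  qed
  define q :: "real vec" where "q = vec n (\<lambda>j. if j = k then -1 else 1)"
  have q: "q \<in> carrier_vec n" by (simp add: q_def)
  obtain x where x: "x \<in> LCP n A q" using assms q by (auto simp: Q_mats_def)
  have xc: "x \<in> carrier_vec n" using x by (simp add: LCP_def)
  note s = x[unfolded mem_LCP[OF xc q]]
  have next_pos: "b i < 0 \<and> 0 < x $ Suc i" if "i < k" "0 < x $ i" for i
  proof -
    have "x $ i * (a i * x $ i + b i * x $ Suc i + q $ i) = 0" using s that by blast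
    then have "a i * x $ i + b i * x $ Suc i + 1 = 0"
      using that n_eq by (simp add: q_def)
    moreover have "0 < a i * x $ i" using a_pos that by simp
    ultimately have "b i * x $ Suc i < 0" by linarith
    moreover have "0 \<le> x $ Suc i" using s that by (cases "Suc i = k") auto
    ultimately show ?thesis by (auto simp: mult_less_0_iff)
  qed
  have x_pos: "0 < x $ i" if "i \<le> k" for i
    using that
  proof (induction i)
    case 0
    have "0 < c * x $ 0" using s n_eq by (simp add: q_def)
    then show ?case using c_pos by (simp add: zero_less_mult_iff)
  next
    case (Suc i)
    then show ?case using next_pos by simp
  qed
  show ?thesis unfolding sign_cond_def using a_pos next_pos x_pos by auto
qed

lemma Rstar_imp_sign_cond:
  assumes "A \<in> Rstar_mats n"
  shows "sign_cond"
proof -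
  have R0: "LCP n A (0\<^sub>v n) = {0\<^sub>v n}" using assms by (simp add: Rstar_mats_def R0_mats_def)
  have E0: "\<And>d. pos_vec n d \<Longrightarrow> LCP n A d = {0\<^sub>v n}"
    using assms by (simp add: Rstar_mats_def E0_mats_def)
  have a_nonneg: "0 \<le> a i" if "i < k" for i
  proof (rule ccontr)
    assume neg: "\<not> 0 \<le> a i"
    define x :: "real vec" where "x = unit_vec n i"
    have xc: "x \<in> carrier_vec n" by (simp add: x_def)
    \<comment> \<open>The entry at \<open>i\<close> cancels the slack where \<open>x\<close> is
      nonzero; the others are large enough for positive slack elsewhere.\<close>
    define d where "d = vec n (\<lambda>j. if j = i then - a i else 1 + \<bar>(A *\<^sub>v x) $ j\<bar>)"
    have dc: "d \<in> carrier_vec n" by (simp add: d_def)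
    have "pos_vec n d" using neg by (auto simp: pos_vec_def d_def)
    moreover have "(A *\<^sub>v x) $ i = a i"
      unfolding mult_vec_row[OF xc that] using that n_eq by (simp add: x_def)
    then have "x \<in> LCP n A d"
      unfolding mem_LCP_iff[OF carrier xc dc] using that n_eq by (auto simp: d_def x_def)
    ultimately have "x = 0\<^sub>v n" using E0 by auto
    then have "x $ i = 0\<^sub>v n $ i" by simp
    then show False using that n_eq by (simp add: x_def)
  qed
  \<comment> \<open>Two obstructions are merged: a chain started with 1 at index \<open>m\<close>
    solves the homogeneous problem if \<open>m < k\<close> and \<open>a m = 0\<close>, or if
    \<open>m = k\<close> and its first component is 0. Both contradict R0.\<close>
  have chain_not_sol: "\<not> ((m < k \<longrightarrow> a m = 0) \<and> (m = k \<longrightarrow> chain a b (\<lambda>_. 0) k 1 0 = 0))"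
    if "m \<le> k" "\<And>i. i < m \<Longrightarrow> 0 < a i" for m
  proof
    assume m: "(m < k \<longrightarrow> a m = 0) \<and> (m = k \<longrightarrow> chain a b (\<lambda>_. 0) k 1 0 = 0)"
    define f where "f = chain a b (\<lambda>_. 0) m 1"
    have f_nonneg: "0 \<le> f i" for i by (simp add: f_def chain_nonneg)
    have row: "0 \<le> a i * f i + b i * f (Suc i) \<and> f i * (a i * f i + b i * f (Suc i)) = 0"
      if "i < k" for i
    proof (cases i m rule: linorder_cases)
      case less
      then show ?thesis
        using chain_complementary[of i m a b "\<lambda>_. 0" 1] \<open>\<And>i. i < m \<Longrightarrow> 0 < a i\<close>
        by (simp add: f_def)
    next
      case equal
      then show ?thesis using m that by (simp add: f_def chain_above)
    next
      case greater
      then show ?thesis by (simp add: f_def chain_above)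
    qed
    have "f k * (c * f 0) = 0"
      using m \<open>m \<le> k\<close> by (cases "m = k") (auto simp: f_def chain_above)
    then have "vec n f \<in> LCP n A (0\<^sub>v n)"
      using row f_nonneg c_pos n_eq by (subst mem_LCP) auto
    then have "vec n f = 0\<^sub>v n" using R0 by auto
    then have "vec n f $ m = 0\<^sub>v n $ m" by simp
    then show False using \<open>m \<le> k\<close> n_eq by (simp add: f_def)
  qed
  have a_pos: "0 < a i" if "i < k" for i
    using that
  proof (induction i rule: less_induct)
    case (less i)
    then have "a i \<noteq> 0" using chain_not_sol[of i] by auto
    then show ?case using a_nonneg[OF less.prems] by simp
  qed
  have "b i < 0" if "i < k" for i
  proof (rule ccontr)
    assume "\<not> b i < 0"
    \<comment> \<open>A nonnegative \<open>b i\<close> truncates the full chain to 0 at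
      \<open>i\<close>, hence also at index 0, which is the case \<open>m = k\<close> above.\<close>
    then have "0 \<le> b i * chain a b (\<lambda>_. 0) k 1 (Suc i) / a i"
      using a_pos[OF that] by (simp add: chain_nonneg)
    then have "chain a b (\<lambda>_. 0) k 1 i = 0"
      by (simp add: chain_step[OF that] max_absorb1)
    then have "chain a b (\<lambda>_. 0) k 1 0 = 0"
      using chain_zero_below[of a b k 1 i 0] that by simp
    then show False using chain_not_sol[of k] a_pos by simp
  qed
  then show ?thesis using a_pos by (simp add: sign_cond_def)
qed

text \<open>The corner is the only entry of the last row that can be nonzero. Deleting its row and
  column shifts the superdiagonal onto the diagonal of a lower triangular matrix, and the cofactor
  sign is spread over the \<open>k\<close> factors.\<close>

lemma det_eq: "det A = c * (\<Prod>i<k. - b i)"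
proof -
  define B where "B = mat_delete A k 0"
  have Bc: "B \<in> carrier_mat k k"
    using mat_delete_carrier[OF carrier] n_eq by (simp add: B_def)
  have Bij: "B $$ (i, j) = A $$ (i, Suc j)" if "i < k" "j < k" for i j
    using that carrier n_eq by (simp add: B_def mat_delete_def)
  have "A $$ (k, j) = 0" if "j < n" "j \<noteq> 0" for j
    using that last_diag entry_zero[of k j] n_eq by (cases "j = k") auto
  then have "(\<Sum>j<n. A $$ (k, j) * cofactor A k j) = (\<Sum>j\<in>{0}. A $$ (k, j) * cofactor A k j)"
    using n_eq by (intro sum.mono_neutral_right) auto
  moreover have "det A = (\<Sum>j<n. A $$ (k, j) * cofactor A k j)"
    using laplace_expansion_row[OF carrier, of k] n_eq by simp
  ultimately have "det A = c * ((-1) ^ k * det B)"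
    using n_eq by (simp add: cofactor_def B_def c_def)
  also have "det B = prod_list (diag_mat B)"
    using Bij entry_zero n_eq by (intro det_lower_triangular[OF _ Bc]) auto
  also have "\<dots> = (\<Prod>i<k. b i)"
    using Bc Bij by (simp add: prod_list_diag_prod lessThan_atLeast0 b_def)
  also have "(-1) ^ k * (\<Prod>i<k. b i) = (\<Prod>i<k. - b i)"
    by (simp add: prod_uminus)
  finally show ?thesis .
qed

lemma sign_cond_imp_det_pos: "sign_cond \<Longrightarrow> 0 < det A"
  unfolding det_eq sign_cond_def using c_pos by (auto intro!: mult_pos_pos prod_pos)

end

theorem theorem5p2:
  fixes A :: "real mat" and n :: nat
  assumes "n \<ge> 2"
    and "bdsw n A"
    and "A $$ (n - 1, 0) > 0"
    and "A $$ (n - 1, n - 1) = 0"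
  defines "cond_ii \<equiv> (\<forall>i<n - 1. A $$ (i, i) > 0) \<and> (\<forall>i<n - 1. A $$ (i, i + 1) < 0)"
  shows "(A \<in> Q_mats n \<longleftrightarrow> cond_ii) \<and>
         (cond_ii \<longleftrightarrow> A \<in> Rstar_mats n) \<and>
         ((A \<in> Q_mats n \<or> cond_ii \<or> A \<in> Rstar_mats n) \<longrightarrow> det A > 0)"
proof -
  interpret bdsw_lcp A n "n - 1"
    using assms by unfold_locales auto
  have "cond_ii \<longleftrightarrow> sign_cond"
    unfolding cond_ii_def sign_cond_def a_def b_def ..
  then show ?thesis
    using sign_cond_imp_Q Q_imp_sign_cond sign_cond_imp_Rstar Rstar_imp_sign_cond
      sign_cond_imp_det_pos by blast
qed

end
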